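(* Let $f(x)=\sum_{\alpha\in A^+}c_\alpha e^{\langle x,\alpha\rangle}+c_\beta e^{\langle x,\beta\rangle}$ be a circuit function with support $A=A^+\cup\{\beta\}\subset\mathbb{R}^n$. Then $f$ is an element of the DSONC cone $D_A$ corresponding to $A$ if and only if $$-c_\beta\ \le\ \check\Theta_f .$$
   Context: A (simplicial) circuit with inner point is a set $A=A^+\cup\{\beta\}\subset\mathbb{R}^n$ where $A^+$ is a finite affinely independent set with at least two points and $\beta$ is in the relative interior of the simplex $\mathrm{conv}(A^+)$. A circuit function with support $A=A^+\cup\{\beta\}$ is an exponential sum $f(x)=\sum_{\alpha\in A^+}c_\alpha e^{\langle x,\alpha\rangle}+c_\beta e^{\langle x,\beta\rangle}$ with $c_\alpha>0$ for all $\alpha\in A^+$ and $c_\beta\in\mathbb{R}\setminus\{0\}$. The dual circuit number of $f$ is $\check\Theta_f=\prod_{\alpha\in A^+}c_\alpha^{\lambda_\alpha}$, where $\lambda\in(0,1)^{A^+}$ is the unique vector of barycentric coordinates: $\sum_{\alpha}\lambda_\alpha\alpha=\beta$, $\sum_\alpha\lambda_\alpha=1$. DSONC cone: for a finite set $A\subset\mathbb{R}^n$, $\mathbb{R}^A$ is the vector space of exponential sums $\sum_{\alpha\in A}c_\alpha e^{\langle x,\alpha\rangle}$. For $B^+\subset\mathbb{R}^n$ finite and $\gamma\in\mathrm{conv}(B^+)\setminus B^+$ let $\Lambda(B^+,\gamma)=\{\lambda\in\mathbb{R}_{\ge0}^{B^+}:\sum_{\alpha}\lambda_\alpha\alpha=\gamma,\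 \sum_{\alpha}\lambda_\alpha=1\}$ and let $D_{B^+,\gamma}$ be the set of all $g(x)=\sum_{\alpha\in B^+}d_\alpha e^{\langle x,\alpha\rangle}+d_\gamma e^{\langle x,\gamma\rangle}$ with $d_\alpha\ge0$ for all $\alpha\in B^+$ and such that either $d_\gamma\ge0$, or $\ln|d_\gamma|\le\sum_{\alpha\in B^+}\lambda_\alpha\ln(d_\alpha)$ for all $\lambda\in\Lambda(B^+,\gamma)$ (conventions $\ln 0=-\infty$, $0\cdot(-\infty)=0$). The DSONC cone $D_A\subset\mathbb{R}^A$ is the convex cone generated by the exponential monomials $e^{\langle x,\alpha\rangle}$, $\alpha\in A$, together with all sets $D_{B^+,\gamma}$ where $B^+\subseteq A$ and $\gamma\in A\setminus B^+$ with $\gamma\in\mathrm{conv}(B^+)$. *)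

theory Defs
  imports "HOL-Analysis.Analysis"
begin

definition expsum :: "(real^'n) set \<Rightarrow> (real^'n \<Rightarrow> real) \<Rightarrow> real^'n \<Rightarrow> real" where
  "expsum A c = (\<lambda>x. \<Sum>\<alpha>\<in>A. c \<alpha> * exp (x \<bullet> \<alpha>))"

definition simplicial_circuit :: "(real^'n) set \<Rightarrow> real^'n \<Rightarrow> bool" where
  "simplicial_circuit Ap \<beta> \<longleftrightarrow>
     finite Ap \<and> card Ap \<ge> 2 \<and> \<not> affine_dependent Ap \<and> \<beta> \<in> rel_interior (convex hull Ap)"

definition circuit_function ::
    "(real^'n) set \<Rightarrow> real^'n \<Rightarrow> (real^'n \<Rightarrow> real) \<Rightarrow> (real^'n \<Rightarrow> real) \<Rightarrow> bool" where
  "circuit_function Ap \<beta> c f \<longleftrightarrow>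
     simplicial_circuit Ap \<beta> \<and> (\<forall>\<alpha>\<in>Ap. c \<alpha> > 0) \<and> c \<beta> \<noteq> 0 \<and>
     f = (\<lambda>x. (\<Sum>\<alpha>\<in>Ap. c \<alpha> * exp (x \<bullet> \<alpha>)) + c \<beta> * exp (x \<bullet> \<beta>))"

(* A vector indexed by Ap is a function on the whole space; requiring it to vanish off Ap is what
   makes the barycentric coordinate vector unique as a function. *)
definition is_barycentric :: "(real^'n) set \<Rightarrow> real^'n \<Rightarrow> (real^'n \<Rightarrow> real) \<Rightarrow> bool" where
  "is_barycentric Ap \<beta> l \<longleftrightarrow>
     (\<forall>\<alpha>\<in>Ap. 0 < l \<alpha> \<and> l \<alpha> < 1) \<and> (\<forall>\<alpha>. \<alpha> \<notin> Ap \<longrightarrow> l \<alpha> = 0) \<and>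
     (\<Sum>\<alpha>\<in>Ap. l \<alpha> *\<^sub>R \<alpha>) = \<beta> \<and> (\<Sum>\<alpha>\<in>Ap. l \<alpha>) = 1"

definition barycentric :: "(real^'n) set \<Rightarrow> real^'n \<Rightarrow> real^'n \<Rightarrow> real" where
  "barycentric Ap \<beta> = (THE l. is_barycentric Ap \<beta> l)"

definition dual_circuit_number :: "(real^'n) set \<Rightarrow> real^'n \<Rightarrow> (real^'n \<Rightarrow> real) \<Rightarrow> real" where
  "dual_circuit_number Ap \<beta> c = (\<Prod>\<alpha>\<in>Ap. c \<alpha> powr barycentric Ap \<beta> \<alpha>)"

definition bary_weights :: "(real^'n) set \<Rightarrow> real^'n \<Rightarrow> (real^'n \<Rightarrow> real) set" where
  "bary_weights B \<gamma> =
     {l. (\<forall>\<alpha>\<in>B. 0 \<le> l \<alpha>) \<and> (\<Sum>\<alpha>\<in>B. l \<alpha> *\<^sub>R \<alpha>) = \<gamma> \<and> (\<Sum>\<alpha>\<in>B. l \<alpha>) = 1}"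

(* The logarithm on the nonnegative reals with ln 0 = -infinity; the convention
   0 * (-infinity) = 0 is the one built into multiplication on ereal. *)
definition eln :: "real \<Rightarrow> ereal" where
  "eln t = (if t \<le> 0 then - \<infinity> else ereal (ln t))"

definition dsonc_piece :: "(real^'n) set \<Rightarrow> real^'n \<Rightarrow> (real^'n \<Rightarrow> real) set" where
  "dsonc_piece B \<gamma> =
     {g. \<exists>d. g = (\<lambda>x. (\<Sum>\<alpha>\<in>B. d \<alpha> * exp (x \<bullet> \<alpha>)) + d \<gamma> * exp (x \<bullet> \<gamma>)) \<and>
             (\<forall>\<alpha>\<in>B. d \<alpha> \<ge> 0) \<and>
             (d \<gamma> \<ge> 0 \<or>
              (\<forall>l\<in>bary_weights B \<gamma>. eln \<bar>d \<gamma>\<bar> \<le> (\<Sum>\<alpha>\<in>B. ereal (l \<alpha>) * eln (d \<alpha>))))}"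

(* The library's convex_cone needs a real_vector instance, which the function type lacks. This is
   its characterisation convex_cone_iff, with pointwise operations. *)
definition fun_convex_cone :: "('a \<Rightarrow> real) set \<Rightarrow> bool" where
  "fun_convex_cone C \<longleftrightarrow>
     (\<lambda>x. 0) \<in> C \<and> (\<forall>f\<in>C. \<forall>g\<in>C. (\<lambda>x. f x + g x) \<in> C) \<and> (\<forall>f\<in>C. \<forall>t\<ge>0. (\<lambda>x. t * f x) \<in> C)"

definition dsonc_cone :: "(real^'n) set \<Rightarrow> (real^'n \<Rightarrow> real) set" where
  "dsonc_cone A = fun_convex_cone hull
     ({\<lambda>x. exp (x \<bullet> \<alpha>) | \<alpha>. \<alpha> \<in> A} \<union>
      \<Union> {dsonc_piece B \<gamma> | B \<gamma>. B \<subseteq> A \<and> \<gamma> \<in> A - B \<and> \<gamma> \<in> convex hull B})"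

lemma inner_point_not_vertex:
  assumes "simplicial_circuit Ap \<beta>"
  shows "\<beta> \<notin> Ap"
proof
  assume b: "\<beta> \<in> Ap"
  have "\<beta> extreme_point_of (convex hull Ap)"
    using assms b by (simp add: simplicial_circuit_def extreme_point_of_convex_hull_affine_independent)
  moreover have "convex hull Ap \<noteq> {\<beta>}"
  proof
    assume "convex hull Ap = {\<beta>}"
    then have "Ap \<subseteq> {\<beta>}" using hull_subset by metis
    then have "card Ap \<le> 1" using card_mono[of "{\<beta>}" Ap] by simp
    then show False using assms by (simp add: simplicial_circuit_def)
  qed
  ultimately show False
    using assms extreme_point_not_in_REL_INTERIOR[of \<beta> "convex hull Ap"]
    by (simp add: simplicial_circuit_def)
qed

lemma barycentric_exists_unique:
  assumes "simplicial_circuit Ap \<beta>"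
  shows "\<exists>!l. is_barycentric Ap \<beta> l"
proof -
  have fin: "finite Ap" and ind: "\<not> affine_dependent Ap" and c2: "card Ap \<ge> 2"
    and ri: "\<beta> \<in> rel_interior (convex hull Ap)"
    using assms by (auto simp: simplicial_circuit_def)
  obtain u where u: "\<forall>x\<in>Ap. 0 < u x" "sum u Ap = 1" "(\<Sum>x\<in>Ap. u x *\<^sub>R x) = \<beta>"
    using ri rel_interior_convex_hull_explicit[OF ind] by auto
  define l where "l = (\<lambda>x. if x \<in> Ap then u x else 0)"
  have u1: "u a < 1" if a: "a \<in> Ap" for a
  proof -
    have "Ap - {a} \<noteq> {}"
      using c2 by (metis One_nat_def Suc_1 a card.empty card.insert_remove card_Suc_Diff1 empty_iff
          fin finite.emptyI not_less_eq_eq order_refl)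
    then have "0 < sum u (Ap - {a})" using u(1) fin by (intro sum_pos) auto
    then show ?thesis using sum.remove[OF fin a, of u] u(2) by linarith
  qed
  have "is_barycentric Ap \<beta> l"
    using u u1 by (simp add: is_barycentric_def l_def)
  moreover have "k = m" if k: "is_barycentric Ap \<beta> k" and m: "is_barycentric Ap \<beta> m" for k m
  proof
    fix x
    have s: "sum (\<lambda>v. k v - m v) Ap = 0" "(\<Sum>v\<in>Ap. (k v - m v) *\<^sub>R v) = 0"
      using k m by (simp_all add: is_barycentric_def sum_subtractf scaleR_diff_left)
    have "\<forall>v\<in>Ap. k v - m v = 0"
      using ind s unfolding affine_dependent_explicit_finite[OF fin] by blast
    then show "k x = m x" using k m by (cases "x \<in> Ap") (auto simp: is_barycentric_def)
  qed
  ultimately show ?thesis by blast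
qed

lemma circuit_function_expsum:
  assumes "circuit_function Ap \<beta> c f"
  shows "f = expsum (insert \<beta> Ap) c"
proof -
  have "\<beta> \<notin> Ap" "finite Ap"
    using assms inner_point_not_vertex by (auto simp: circuit_function_def simplicial_circuit_def)
  then show ?thesis using assms by (auto simp: circuit_function_def expsum_def)
qed

lemma dsonc_cone_subset_expsums:
  assumes "finite A"
  shows "dsonc_cone A \<subseteq> range (expsum A)"
  unfolding dsonc_cone_def
proof (rule hull_minimal)
  show "fun_convex_cone (range (expsum A))"
    unfolding fun_convex_cone_def
  proof (intro conjI ballI allI impI)
    have "(\<lambda>x. 0) = expsum A (\<lambda>_. 0)" by (simp add: expsum_def)
    then show "(\<lambda>x. 0) \<in> range (expsum A)" by blast
  next
    fix f g assume "f \<in> range (expsum A)" "g \<in> range (expsum A)"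
    then obtain c d where "f = expsum A c" "g = expsum A d" by blast
    then have "(\<lambda>x. f x + g x) = expsum A (\<lambda>\<alpha>. c \<alpha> + d \<alpha>)"
      by (simp add: expsum_def sum.distrib distrib_right)
    then show "(\<lambda>x. f x + g x) \<in> range (expsum A)" by blast
  next
    fix f and t :: real assume "f \<in> range (expsum A)"
    then obtain c where "f = expsum A c" by blast
    then have "(\<lambda>x. t * f x) = expsum A (\<lambda>\<alpha>. t * c \<alpha>)"
      by (simp add: expsum_def sum_distrib_left mult.assoc)
    then show "(\<lambda>x. t * f x) \<in> range (expsum A)" by blast
  qed
  have mono: "(\<lambda>x. exp (x \<bullet> \<alpha>)) \<in> range (expsum A)" if "\<alpha> \<in> A" for \<alpha>
  proof -
    have "(\<lambda>x. exp (x \<bullet> \<alpha>)) = expsum A (\<lambda>v. if v = \<alpha> then 1 else 0)"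
      using that assms by (simp add: expsum_def if_distrib[of "\<lambda>t. t * _"] sum.delta cong: if_cong)
    then show ?thesis by blast
  qed
  have piece: "dsonc_piece B \<gamma> \<subseteq> range (expsum A)" if "B \<subseteq> A" "\<gamma> \<in> A - B" for B \<gamma>
  proof
    fix g assume "g \<in> dsonc_piece B \<gamma>"
    then obtain d where g: "g = (\<lambda>x. (\<Sum>\<alpha>\<in>B. d \<alpha> * exp (x \<bullet> \<alpha>)) + d \<gamma> * exp (x \<bullet> \<gamma>))"
      by (auto simp: dsonc_piece_def)
    have fB: "finite B" using that assms finite_subset by blast
    have "g = expsum A (\<lambda>v. if v \<in> insert \<gamma> B then d v else 0)"
    proof
      fix x
      have "expsum A (\<lambda>v. if v \<in> insert \<gamma> B then d v else 0) x
            = (\<Sum>\<alpha>\<in>insert \<gamma> B. d \<alpha> * exp (x \<bullet> \<alpha>))"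
        unfolding expsum_def using that assms
        by (intro sum.mono_neutral_cong_right) auto
      also have "\<dots> = g x" using that fB by (simp add: g)
      finally show "g x = expsum A (\<lambda>v. if v \<in> insert \<gamma> B then d v else 0) x" by simp
    qed
    then show "g \<in> range (expsum A)" by blast
  qed
  show "{\<lambda>x. exp (x \<bullet> \<alpha>) | \<alpha>. \<alpha> \<in> A} \<union>
      \<Union> {dsonc_piece B \<gamma> | B \<gamma>. B \<subseteq> A \<and> \<gamma> \<in> A - B \<and> \<gamma> \<in> convex hull B}
      \<subseteq> range (expsum A)"
    using mono piece by blast
qed

end

theory Submission
  imports Defs
begin

text \<open>
  By the weighted AM-GM inequality the weighted geometric mean is superadditive, so the sums with
  nonnegative coefficients on \<open>Ap\<close> that satisfy the asserted inequality form a convex cone.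
  A set \<open>D\<^bsub>B,\<gamma>\<^esub>\<close> occurring in the definition of the DSONC cone must have \<open>\<gamma> = \<beta>\<close>, since the elements of
  \<open>Ap\<close> are extreme points of the simplex, and then \<open>B = Ap\<close>, since the barycentric coordinates of \<open>\<beta>\<close>
  are unique and positive. Hence this cone contains all generators. Coefficients can be
  read off because exponentials with distinct exponents are linearly independent.
\<close>

section \<open>Weighted geometric means\<close>

text \<open>Jensen's inequality for \<open>exp\<close> at the points \<open>ln (y i)\<close>; a
  vanishing \<open>y i\<close> has no such point and is treated apart.\<close>

lemma weighted_arith_geom_mean:
  fixes l y :: "'a \<Rightarrow> real"
  assumes "finite I" and l: "\<And>i. i \<in> I \<Longrightarrow> 0 \<le> l i" and l1: "sum l I = 1"
    and y: "\<And>i. i \<in> I \<Longrightarrow> 0 \<le> y i"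
  shows "(\<Prod>i\<in>I. y i powr l i) \<le> (\<Sum>i\<in>I. l i * y i)"
proof (cases "\<exists>i\<in>I. y i = 0")
  case True
  \<comment> \<open>\<open>0 powr r\<close> is 0 for every \<open>r\<close>, including
    \<open>r = 0\<close>, so a zero entry kills the product whatever its weight.\<close>
  then have "(\<Prod>i\<in>I. y i powr l i) = 0"
    using \<open>finite I\<close> by auto
  then show ?thesis
    using l y by (simp add: sum_nonneg)
next
  case False
  then have pos: "\<And>i. i \<in> I \<Longrightarrow> 0 < y i"
    using y by (metis less_eq_real_def)
  have "I \<noteq> {}" using l1 by auto
  have "exp (\<Sum>i\<in>I. l i *\<^sub>R ln (y i)) \<le> (\<Sum>i\<in>I. l i * exp (ln (y i)))"
    by (rule convex_on_sum[OF \<open>finite I\<close> \<open>I \<noteq> {}\<close> exp_convex l1 l]) auto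
  also have "\<dots> = (\<Sum>i\<in>I. l i * y i)"
    using pos by simp
  finally show ?thesis
    using pos \<open>finite I\<close> by (simp add: exp_sum powr_def less_imp_neq[THEN not_sym] cong: prod.cong)
qed

text \<open>After division by the geometric mean of \<open>a + b\<close>, AM-GM bounds the two
  quotients by arithmetic means that add up to \<open>sum l I\<close>, which is 1.\<close>

lemma weighted_geom_mean_superadditive:
  fixes l a b :: "'a \<Rightarrow> real"
  assumes fin: "finite I" and l: "\<And>i. i \<in> I \<Longrightarrow> 0 \<le> l i" and l1: "sum l I = 1"
    and a: "\<And>i. i \<in> I \<Longrightarrow> 0 \<le> a i" and b: "\<And>i. i \<in> I \<Longrightarrow> 0 \<le> b i"
  shows "(\<Prod>i\<in>I. a i powr l i) + (\<Prod>i\<in>I. b i powr l i) \<le> (\<Prod>i\<in>I. (a i + b i) powr l i)"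
proof (cases "\<exists>i\<in>I. a i + b i = 0")
  case True
  then obtain i where "i \<in> I" "a i = 0" "b i = 0"
    using a b by (metis add_nonneg_eq_0_iff)
  then have "(\<Prod>i\<in>I. a i powr l i) = 0" "(\<Prod>i\<in>I. b i powr l i) = 0"
    using fin by auto
  then show ?thesis by (simp add: prod_nonneg)
next
  case False
  define s where "s i = a i + b i" for i
  have s: "0 < s i" if "i \<in> I" for i
    using False a[OF that] b[OF that] that unfolding s_def by (metis add_nonneg_nonneg less_eq_real_def)
  have split: "(\<Prod>i\<in>I. y i powr l i) = (\<Prod>i\<in>I. s i powr l i) * (\<Prod>i\<in>I. (y i / s i) powr l i)" for y
    unfolding prod.distrib[symmetric] powr_mult[symmetric]
    using s by (intro prod.cong refl) (simp add: less_imp_neq[THEN not_sym])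
  have "(\<Prod>i\<in>I. (a i / s i) powr l i) + (\<Prod>i\<in>I. (b i / s i) powr l i)
      \<le> (\<Sum>i\<in>I. l i * (a i / s i)) + (\<Sum>i\<in>I. l i * (b i / s i))"
    using s a b by (intro add_mono weighted_arith_geom_mean fin l l1) (auto simp: less_imp_le)
  also have "\<dots> = (\<Sum>i\<in>I. l i * ((a i + b i) / s i))"
    by (simp add: sum.distrib distrib_left add_divide_distrib)
  also have "\<dots> = 1"
    using s l1 by (simp add: s_def less_imp_neq[THEN not_sym] cong: sum.cong)
  finally show ?thesis
    unfolding split[of a] split[of b] s_def[symmetric] distrib_left[symmetric]
    by (rule mult_left_le) (simp add: prod_nonneg)
qed

lemma weighted_geom_mean_scale:
  fixes l a :: "'a \<Rightarrow> real"
  assumes "finite I" and l1: "sum l I = 1" and t: "0 \<le> t"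
  shows "(\<Prod>i\<in>I. (t * a i) powr l i) = t * (\<Prod>i\<in>I. a i powr l i)"
proof (cases "t = 0")
  case True
  \<comment> \<open>An empty product would be 1 instead of 0.\<close>
  have "I \<noteq> {}" using l1 by auto
  with True \<open>finite I\<close> show ?thesis by auto
next
  case False
  then show ?thesis
    using l1 t by (simp add: powr_mult prod.distrib flip: powr_sum)
qed

text \<open>Exponentiation turns the weighted sum of logarithms into the product. Positive weights
  make the conventions agree at \<open>d i = 0\<close>: the summand is \<open>-\<infinity>\<close>
  and the factor 0. At weight zero the summand would be 0, but the factor \<open>0 powr 0\<close>
  still 0.\<close>

lemma eln_le_weighted_sum_iff:
  assumes fin: "finite I" and x: "0 < x"
    and l: "\<And>i. i \<in> I \<Longrightarrow> 0 < l i" and d: "\<And>i. i \<in> I \<Longrightarrow> 0 \<le> d i"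
  shows "eln x \<le> (\<Sum>i\<in>I. ereal (l i) * eln (d i)) \<longleftrightarrow> x \<le> (\<Prod>i\<in>I. d i powr l i)"
proof (cases "\<exists>i\<in>I. d i = 0")
  case True
  then obtain i where i: "i \<in> I" "d i = 0" by blast
  have inf: "ereal (l i) * eln (d i) = -\<infinity>"
    using i l[OF i(1)] by (simp add: eln_def)
  \<comment> \<open>On \<open>ereal\<close>, \<open>-\<infinity> + \<infinity>\<close> is
    \<open>\<infinity>\<close>, so \<open>-\<infinity>\<close> absorbs the other summands only once
    this is excluded.\<close>
  have "(\<Sum>j\<in>I - {i}. ereal (l j) * eln (d j)) \<noteq> \<infinity>"
    using l by (auto simp: sum_Pinfty eln_def less_imp_le dest: less_asym)
  then have "(\<Sum>j\<in>I. ereal (l j) * eln (d j)) = -\<infinity>"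
    unfolding sum.remove[OF fin i(1)] inf by simp
  moreover have "(\<Prod>j\<in>I. d j powr l j) = 0"
    using i fin by auto
  ultimately show ?thesis using x by (simp add: eln_def)
next
  case False
  then have pos: "\<And>i. i \<in> I \<Longrightarrow> 0 < d i"
    using d by (metis less_eq_real_def)
  have "(\<Sum>i\<in>I. ereal (l i) * eln (d i)) = ereal (\<Sum>i\<in>I. l i * ln (d i))"
    unfolding sum_ereal[symmetric] using pos by (intro sum.cong) (auto simp: eln_def not_le)
  also have "(\<Sum>i\<in>I. l i * ln (d i)) = ln (\<Prod>i\<in>I. d i powr l i)"
    using pos fin by (subst ln_prod) force+
  finally show ?thesis
    using x pos by (simp add: eln_def prod_pos less_imp_neq[THEN not_sym])
qed

section \<open>Linear independence of exponentials\<close>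

lemma expsum_eq_zero_imp:
  assumes "finite A" and "\<And>x. expsum A c x = 0" and "\<alpha> \<in> A"
  shows "c \<alpha> = 0"
  using assms
proof (induction A arbitrary: c \<alpha> rule: finite_induct)
  case empty
  then show ?case by simp
next
  case (insert a A)
  \<comment> \<open>Dividing by \<open>exp (x \<bullet> a)\<close> makes the term of the new
    exponent constant, so that a difference in \<open>x\<close> can remove it.\<close>
  have zero: "(\<Sum>v\<in>A. c v * exp (x \<bullet> (v - a))) + c a = 0" for x
  proof -
    have "(\<Sum>v\<in>A. c v * exp (x \<bullet> (v - a))) + c a = expsum (insert a A) c x * exp (- (x \<bullet> a))"
      using insert.hyps
      by (simp add: expsum_def inner_diff_right exp_diff exp_minus distrib_right sum_distrib_right
          divide_inverse mult.assoc)
    then show ?thesis using insert.prems(1) by simp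
  qed
  have c0: "c v = 0" if v: "v \<in> A" for v
  proof -
    \<comment> \<open>Subtracting the identity at \<open>x\<close> from the one at \<open>x + y\<close> eliminates the exponent \<open>a\<close>.\<close>
    define y where "y = v - a"
    have "expsum A (\<lambda>w. c w * (exp (y \<bullet> (w - a)) - 1)) x = 0" for x
    proof -
      have "expsum A (\<lambda>w. c w * (exp (y \<bullet> (w - a)) - 1)) x
          = exp (x \<bullet> a) * ((\<Sum>w\<in>A. c w * exp ((x + y) \<bullet> (w - a))) - (\<Sum>w\<in>A. c w * exp (x \<bullet> (w - a))))"
        unfolding expsum_def sum_subtractf[symmetric] sum_distrib_left
        by (intro sum.cong refl)
           (simp add: inner_add_left inner_diff_right exp_add exp_diff field_simps)
      then show ?thesis using zero[of x] zero[of "x + y"] by simp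
    qed
    \<comment> \<open>The shift \<open>y = v - a\<close> is chosen for this factor: it is nonzero as
      soon as \<open>y\<close> is.\<close>
    from insert.IH[OF this v] have "c v * (exp (y \<bullet> y) - 1) = 0"
      by (simp add: y_def)
    moreover have "y \<noteq> 0" using v insert.hyps by (auto simp: y_def)
    ultimately show ?thesis by simp
  qed
  then show ?case
    using zero[of 0] insert.prems(2) by auto
qed

lemma expsum_coeff_unique:
  assumes "finite A" and "expsum A c = expsum A d" and "\<alpha> \<in> A"
  shows "c \<alpha> = d \<alpha>"
proof -
  have "expsum A (\<lambda>v. c v - d v) x = 0" for x
    using fun_cong[OF assms(2), of x] by (simp add: expsum_def left_diff_distrib sum_subtractf)
  from expsum_eq_zero_imp[OF assms(1) this assms(3)] show ?thesis by simp
qed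

section \<open>Barycentric coordinates and the pieces of a circuit\<close>

lemma is_barycentric_barycentric:
  "simplicial_circuit Ap \<beta> \<Longrightarrow> is_barycentric Ap \<beta> (barycentric Ap \<beta>)"
  unfolding barycentric_def by (rule theI'[OF barycentric_exists_unique])

lemma barycentric_in_bary_weights:
  "simplicial_circuit Ap \<beta> \<Longrightarrow> barycentric Ap \<beta> \<in> bary_weights Ap \<beta>"
  using is_barycentric_barycentric[of Ap \<beta>]
  by (auto simp: is_barycentric_def bary_weights_def less_imp_le)

text \<open>The difference of two weight vectors is an affine relation on \<open>Ap\<close>.
  Agreement holds on \<open>Ap\<close> only, since \<open>bary_weights\<close> leaves the values
  elsewhere free.\<close>

lemma bary_weights_unique:
  assumes circ: "simplicial_circuit Ap \<beta>" and u: "u \<in> bary_weights Ap \<beta>" and "\<alpha> \<in> Ap"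
  shows "u \<alpha> = barycentric Ap \<beta> \<alpha>"
proof -
  define w where "w v = u v - barycentric Ap \<beta> v" for v
  have fin: "finite Ap" and ind: "\<not> affine_dependent Ap"
    using circ unfolding simplicial_circuit_def by blast+
  have l: "barycentric Ap \<beta> \<in> bary_weights Ap \<beta>"
    using circ by (rule barycentric_in_bary_weights)
  have "sum u Ap - sum (barycentric Ap \<beta>) Ap = 0"
    using u l unfolding bary_weights_def by simp
  then have sum0: "sum w Ap = 0"
    unfolding w_def sum_subtractf .
  have "(\<Sum>v\<in>Ap. u v *\<^sub>R v) - (\<Sum>v\<in>Ap. barycentric Ap \<beta> v *\<^sub>R v) = 0"
    using u l unfolding bary_weights_def mem_Collect_eq right_minus_eq by (elim conjE) (erule trans, erule sym)
  then have sum1: "(\<Sum>v\<in>Ap. w v *\<^sub>R v) = 0"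
    unfolding w_def scaleR_diff_left sum_subtractf .
  have "w \<alpha> = 0"
  proof (rule ccontr)
    assume "w \<alpha> \<noteq> 0"
    with sum0 sum1 \<open>\<alpha> \<in> Ap\<close> have "affine_dependent Ap"
      unfolding affine_dependent_explicit_finite[OF fin] by (intro exI[of _ w] conjI bexI[of _ \<alpha>])
    with ind show False ..
  qed
  then show ?thesis by (simp add: w_def)
qed

text \<open>Weights over a proper subset, extended by zero, would be barycentric coordinates of
  \<open>\<beta>\<close> with a zero entry, whereas all of them are positive.\<close>

lemma inner_point_hull_subset_eq:
  assumes circ: "simplicial_circuit Ap \<beta>" and "B \<subseteq> Ap" and "\<beta> \<in> convex hull B"
  shows "B = Ap"
proof (rule ccontr)
  assume "B \<noteq> Ap"
  then obtain a where a: "a \<in> Ap" "a \<notin> B" using \<open>B \<subseteq> Ap\<close> by blast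
  have fin: "finite Ap" "finite B"
    using circ \<open>B \<subseteq> Ap\<close> finite_subset by (auto simp: simplicial_circuit_def)
  obtain u where u: "\<forall>v\<in>B. 0 \<le> u v" "sum u B = 1" "(\<Sum>v\<in>B. u v *\<^sub>R v) = \<beta>"
    using \<open>\<beta> \<in> convex hull B\<close> by (auto simp: convex_hull_finite[OF fin(2)])
  define w where "w v = (if v \<in> B then u v else 0)" for v
  have "sum w Ap = 1"
    using u(2) sum.mono_neutral_cong_right[OF fin(1) \<open>B \<subseteq> Ap\<close>, of w u] by (simp add: w_def)
  moreover have "(\<Sum>v\<in>Ap. w v *\<^sub>R v) = \<beta>"
    using u(3) sum.mono_neutral_cong_right[OF fin(1) \<open>B \<subseteq> Ap\<close>, of "\<lambda>v. w v *\<^sub>R v" "\<lambda>v. u v *\<^sub>R v"]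
    by (simp add: w_def)
  ultimately have "w \<in> bary_weights Ap \<beta>"
    using u(1) by (simp add: bary_weights_def w_def)
  then have "barycentric Ap \<beta> a = 0"
    using bary_weights_unique[OF circ] a by (metis w_def)
  then show False
    using is_barycentric_barycentric[OF circ] a by (auto simp: is_barycentric_def)
qed

text \<open>Reduces the generators of the cone, apart from the monomials, to a single piece. A
  priori \<open>B\<close> may contain \<open>\<beta>\<close>, with a vertex as
  \<open>\<gamma>\<close>; extremality of the vertices rules this out.\<close>

lemma circuit_pieces:
  assumes circ: "simplicial_circuit Ap \<beta>"
    and B: "B \<subseteq> insert \<beta> Ap" and \<gamma>: "\<gamma> \<in> insert \<beta> Ap - B" "\<gamma> \<in> convex hull B"
  shows "\<gamma> = \<beta> \<and> B = Ap"
proof -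
  have ind: "\<not> affine_dependent Ap" and "\<beta> \<in> convex hull Ap"
    using circ subsetD[OF rel_interior_subset] unfolding simplicial_circuit_def by blast+
  then have "B \<subseteq> convex hull Ap"
    using B hull_subset[of Ap convex] by blast
  then have sub: "convex hull B \<subseteq> convex hull Ap"
    by (simp add: hull_minimal)
  have "\<gamma> \<notin> Ap"
  proof
    assume "\<gamma> \<in> Ap"
    then have "\<gamma> extreme_point_of (convex hull Ap)"
      using ind by (simp add: extreme_point_of_convex_hull_affine_independent)
    \<comment> \<open>An extreme point stays extreme in any smaller hull that contains it, and the
      extreme points of \<open>convex hull B\<close> lie in \<open>B\<close>.\<close>
    then have "\<gamma> extreme_point_of (convex hull B)"
      using sub \<gamma>(2) unfolding extreme_point_of_def by blast
    from extreme_point_of_convex_hull[OF this] show False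
      using \<gamma>(1) by blast
  qed
  with \<gamma>(1) have "\<gamma> = \<beta>" by blast
  moreover from this have "B \<subseteq> Ap" using B \<gamma>(1) by blast
  ultimately show ?thesis
    using inner_point_hull_subset_eq[OF circ] \<gamma>(2) by blast
qed

section \<open>The DSONC cone of a circuit and its membership criterion\<close>

text \<open>All weight vectors agree on \<open>Ap\<close>, so the quantifier over them collapses to
  one logarithmic inequality, which exponentiates to the bound by the dual circuit number.\<close>

lemma circuit_dsonc_piece:
  assumes circ: "simplicial_circuit Ap \<beta>"
  shows "dsonc_piece Ap \<beta> = {expsum (insert \<beta> Ap) d | d. (\<forall>\<alpha>\<in>Ap. 0 \<le> d \<alpha>) \<and> - d \<beta> \<le> dual_circuit_number Ap \<beta> d}"
proof -
  let ?l = "barycentric Ap \<beta>"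
  have fin: "finite Ap" and "\<beta> \<notin> Ap"
    using circ inner_point_not_vertex[OF circ] by (simp_all add: simplicial_circuit_def)
  have eq: "expsum (insert \<beta> Ap) d = (\<lambda>x. (\<Sum>\<alpha>\<in>Ap. d \<alpha> * exp (x \<bullet> \<alpha>)) + d \<beta> * exp (x \<bullet> \<beta>))" for d
    using fin \<open>\<beta> \<notin> Ap\<close> by (auto simp: expsum_def)
  have pos: "0 < ?l \<alpha>" if "\<alpha> \<in> Ap" for \<alpha>
    using is_barycentric_barycentric[OF circ] that by (simp add: is_barycentric_def)
  have weights: "(\<forall>u\<in>bary_weights Ap \<beta>. P \<le> (\<Sum>\<alpha>\<in>Ap. ereal (u \<alpha>) * eln (d \<alpha>)))
      \<longleftrightarrow> P \<le> (\<Sum>\<alpha>\<in>Ap. ereal (?l \<alpha>) * eln (d \<alpha>))" for P and d :: "real^'a \<Rightarrow> real"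
  proof (intro iffI ballI)
    assume "\<forall>u\<in>bary_weights Ap \<beta>. P \<le> (\<Sum>\<alpha>\<in>Ap. ereal (u \<alpha>) * eln (d \<alpha>))"
    then show "P \<le> (\<Sum>\<alpha>\<in>Ap. ereal (?l \<alpha>) * eln (d \<alpha>))"
      using barycentric_in_bary_weights[OF circ] by (rule bspec)
  next
    fix u assume P: "P \<le> (\<Sum>\<alpha>\<in>Ap. ereal (?l \<alpha>) * eln (d \<alpha>))" and u: "u \<in> bary_weights Ap \<beta>"
    have "(\<Sum>\<alpha>\<in>Ap. ereal (u \<alpha>) * eln (d \<alpha>)) = (\<Sum>\<alpha>\<in>Ap. ereal (?l \<alpha>) * eln (d \<alpha>))"
      by (intro sum.cong refl) (simp only: bary_weights_unique[OF circ u])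
    with P show "P \<le> (\<Sum>\<alpha>\<in>Ap. ereal (u \<alpha>) * eln (d \<alpha>))" by (simp only:)
  qed
  have iff: "(d \<beta> \<ge> 0 \<or> (\<forall>u\<in>bary_weights Ap \<beta>. eln \<bar>d \<beta>\<bar> \<le> (\<Sum>\<alpha>\<in>Ap. ereal (u \<alpha>) * eln (d \<alpha>))))
      \<longleftrightarrow> - d \<beta> \<le> dual_circuit_number Ap \<beta> d" if d: "\<forall>\<alpha>\<in>Ap. 0 \<le> d \<alpha>" for d
  proof (cases "d \<beta> \<ge> 0")
    case True
    \<comment> \<open>This absorbs the alternative \<open>d \<beta> \<ge> 0\<close> into the single
      inequality.\<close>
    have "0 \<le> dual_circuit_number Ap \<beta> d"
      by (simp add: dual_circuit_number_def prod_nonneg)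
    with True show ?thesis by linarith
  next
    case False
    then have abs: "\<bar>d \<beta>\<bar> = - d \<beta>" and "0 < - d \<beta>" by auto
    then have "eln \<bar>d \<beta>\<bar> \<le> (\<Sum>\<alpha>\<in>Ap. ereal (?l \<alpha>) * eln (d \<alpha>)) \<longleftrightarrow> - d \<beta> \<le> dual_circuit_number Ap \<beta> d"
      unfolding abs dual_circuit_number_def using d pos
      by (intro eln_le_weighted_sum_iff fin) auto
    with False show ?thesis
      by (simp only: weights False simp_thms)
  qed
  show ?thesis
    unfolding dsonc_piece_def eq
    by (intro Collect_cong ex_cong1 conj_cong refl) (rule iff)
qed

text \<open>Membership bounds \<open>- d \<beta>\<close> by a superadditive, positively homogeneous
  function of the other coefficients, which is stable under sums and nonnegative multiples.\<close>

lemma fun_convex_cone_circuit_piece: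
  assumes circ: "simplicial_circuit Ap \<beta>"
  shows "fun_convex_cone (dsonc_piece Ap \<beta>)"
proof -
  let ?l = "barycentric Ap \<beta>"
  let ?A = "insert \<beta> Ap"
  have fin: "finite Ap"
    using circ by (simp add: simplicial_circuit_def)
  have l: "\<And>\<alpha>. \<alpha> \<in> Ap \<Longrightarrow> 0 \<le> ?l \<alpha>" "sum ?l Ap = 1"
    using barycentric_in_bary_weights[OF circ] by (auto simp: bary_weights_def)
  show ?thesis
    unfolding fun_convex_cone_def circuit_dsonc_piece[OF circ]
  proof (intro conjI ballI allI impI)
    have "(\<lambda>x. 0) = expsum ?A (\<lambda>_. 0)" by (simp add: expsum_def)
    then show "(\<lambda>x. 0) \<in> {expsum ?A d | d. (\<forall>\<alpha>\<in>Ap. 0 \<le> d \<alpha>) \<and> - d \<beta> \<le> dual_circuit_number Ap \<beta> d}"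
      unfolding mem_Collect_eq by (intro exI[of _ "\<lambda>_. 0"]) (simp add: dual_circuit_number_def prod_nonneg)
  next
    fix f g
    assume "f \<in> {expsum ?A d | d. (\<forall>\<alpha>\<in>Ap. 0 \<le> d \<alpha>) \<and> - d \<beta> \<le> dual_circuit_number Ap \<beta> d}"
      and "g \<in> {expsum ?A d | d. (\<forall>\<alpha>\<in>Ap. 0 \<le> d \<alpha>) \<and> - d \<beta> \<le> dual_circuit_number Ap \<beta> d}"
    then obtain c d where c: "f = expsum ?A c" "\<forall>\<alpha>\<in>Ap. 0 \<le> c \<alpha>" "- c \<beta> \<le> dual_circuit_number Ap \<beta> c"
      and d: "g = expsum ?A d" "\<forall>\<alpha>\<in>Ap. 0 \<le> d \<alpha>" "- d \<beta> \<le> dual_circuit_number Ap \<beta> d"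
      by blast
    have "(\<lambda>x. f x + g x) = expsum ?A (\<lambda>\<alpha>. c \<alpha> + d \<alpha>)"
      by (simp add: c d expsum_def sum.distrib distrib_right)
    moreover have "dual_circuit_number Ap \<beta> c + dual_circuit_number Ap \<beta> d
        \<le> dual_circuit_number Ap \<beta> (\<lambda>\<alpha>. c \<alpha> + d \<alpha>)"
      unfolding dual_circuit_number_def
      using c(2) d(2) by (intro weighted_geom_mean_superadditive fin l) auto
    ultimately show "(\<lambda>x. f x + g x) \<in>
        {expsum ?A d | d. (\<forall>\<alpha>\<in>Ap. 0 \<le> d \<alpha>) \<and> - d \<beta> \<le> dual_circuit_number Ap \<beta> d}"
      using c(2,3) d(2,3) unfolding mem_Collect_eq by (intro exI[of _ "\<lambda>\<alpha>. c \<alpha> + d \<alpha>"]) simp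
  next
    fix f and t :: real
    assume "f \<in> {expsum ?A d | d. (\<forall>\<alpha>\<in>Ap. 0 \<le> d \<alpha>) \<and> - d \<beta> \<le> dual_circuit_number Ap \<beta> d}"
      and t: "0 \<le> t"
    then obtain d where d: "f = expsum ?A d" "\<forall>\<alpha>\<in>Ap. 0 \<le> d \<alpha>" "- d \<beta> \<le> dual_circuit_number Ap \<beta> d"
      by blast
    have "(\<lambda>x. t * f x) = expsum ?A (\<lambda>\<alpha>. t * d \<alpha>)"
      by (simp add: d expsum_def sum_distrib_left mult.assoc)
    moreover have "dual_circuit_number Ap \<beta> (\<lambda>\<alpha>. t * d \<alpha>) = t * dual_circuit_number Ap \<beta> d"
      unfolding dual_circuit_number_def by (rule weighted_geom_mean_scale[OF fin l(2) t])
    moreover have "- (t * d \<beta>) \<le> t * dual_circuit_number Ap \<beta> d"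
      using mult_left_mono[OF d(3) t] by simp
    ultimately show "(\<lambda>x. t * f x) \<in>
        {expsum ?A d | d. (\<forall>\<alpha>\<in>Ap. 0 \<le> d \<alpha>) \<and> - d \<beta> \<le> dual_circuit_number Ap \<beta> d}"
      using d(2) t unfolding mem_Collect_eq by (intro exI[of _ "\<lambda>\<alpha>. t * d \<alpha>"]) simp
  qed
qed

text \<open>The piece is already a convex cone and contains the monomials, so the hull adds nothing;
  conversely \<open>Ap\<close> and \<open>\<beta>\<close> form an admissible pair.\<close>

lemma circuit_dsonc_cone:
  assumes circ: "simplicial_circuit Ap \<beta>"
  shows "dsonc_cone (insert \<beta> Ap) = dsonc_piece Ap \<beta>"
proof
  have fin: "finite Ap" and \<beta>: "\<beta> \<notin> Ap" "\<beta> \<in> convex hull Ap"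
    using circ inner_point_not_vertex[OF circ] subsetD[OF rel_interior_subset]
    unfolding simplicial_circuit_def by blast+
  have "(\<lambda>x. exp (x \<bullet> \<alpha>)) \<in> dsonc_piece Ap \<beta>" if "\<alpha> \<in> insert \<beta> Ap" for \<alpha>
  proof -
    \<comment> \<open>These coefficients serve vertices and the inner point alike, because
      \<open>- d \<beta> \<le> 0\<close> in both cases.\<close>
    define d where "d v = (if v = \<alpha> then 1 else 0::real)" for v
    have "(\<lambda>x. exp (x \<bullet> \<alpha>)) = expsum (insert \<beta> Ap) d"
      using that fin
      by (simp add: d_def expsum_def if_distrib[of "\<lambda>t. t * _"] sum.delta cong: if_cong del: sum.insert)
    moreover have "0 \<le> dual_circuit_number Ap \<beta> d"
      by (simp add: dual_circuit_number_def prod_nonneg)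
    moreover have "\<forall>v. 0 \<le> d v" by (simp add: d_def)
    ultimately show ?thesis
      unfolding circuit_dsonc_piece[OF circ] by (auto intro!: exI[of _ d] intro: order_trans[of _ 0])
  qed
  moreover have "dsonc_piece B \<gamma> \<subseteq> dsonc_piece Ap \<beta>"
    if "B \<subseteq> insert \<beta> Ap" "\<gamma> \<in> insert \<beta> Ap - B" "\<gamma> \<in> convex hull B" for B \<gamma>
    using circuit_pieces[OF circ that] by simp
  ultimately show "dsonc_cone (insert \<beta> Ap) \<subseteq> dsonc_piece Ap \<beta>"
    unfolding dsonc_cone_def
    by (intro hull_minimal fun_convex_cone_circuit_piece[OF circ]) blast
  have "dsonc_piece Ap \<beta> \<subseteq> \<Union> {dsonc_piece B \<gamma> | B \<gamma>. B \<subseteq> insert \<beta> Ap \<and> \<gamma> \<in> insert \<beta> Ap - B \<and> \<gamma> \<in> convex hull B}"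
    using \<beta> by (intro Union_upper) blast
  then show "dsonc_piece Ap \<beta> \<subseteq> dsonc_cone (insert \<beta> Ap)"
    unfolding dsonc_cone_def by (meson hull_subset le_supE order_trans)
qed

theorem corollary4p4:
  fixes Ap :: "(real^'n) set" and \<beta> :: "real^'n"
    and c :: "real^'n \<Rightarrow> real" and f :: "real^'n \<Rightarrow> real"
  assumes "circuit_function Ap \<beta> c f"
  shows "f \<in> dsonc_cone (insert \<beta> Ap) \<longleftrightarrow> - c \<beta> \<le> dual_circuit_number Ap \<beta> c"
proof -
  have circ: "simplicial_circuit Ap \<beta>" and c: "\<forall>\<alpha>\<in>Ap. 0 \<le> c \<alpha>"
    using assms by (auto simp: circuit_function_def less_imp_le)
  have fin: "finite (insert \<beta> Ap)"
    using circ by (simp add: simplicial_circuit_def)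
  have f: "f = expsum (insert \<beta> Ap) c"
    using assms by (rule circuit_function_expsum)
  \<comment> \<open>Membership only yields some representation \<open>d\<close> of \<open>f\<close>.
    It agrees with \<open>c\<close> on the support, and the dual circuit number reads its
    coefficients only on \<open>Ap\<close>.\<close>
  have coeff: "d \<beta> = c \<beta> \<and> dual_circuit_number Ap \<beta> d = dual_circuit_number Ap \<beta> c"
    if "f = expsum (insert \<beta> Ap) d" for d
    using expsum_coeff_unique[OF fin, of d c] that f by (simp add: dual_circuit_number_def)
  have "f \<in> dsonc_cone (insert \<beta> Ap) \<longleftrightarrow>
      (\<exists>d. f = expsum (insert \<beta> Ap) d \<and> (\<forall>\<alpha>\<in>Ap. 0 \<le> d \<alpha>) \<and> - d \<beta> \<le> dual_circuit_number Ap \<beta> d)"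
    by (simp only: circuit_dsonc_cone[OF circ] circuit_dsonc_piece[OF circ] mem_Collect_eq)
  also have "\<dots> \<longleftrightarrow> - c \<beta> \<le> dual_circuit_number Ap \<beta> c"
    \<comment> \<open>For the converse direction \<open>c\<close> itself is the witness.\<close>
    using coeff f c by metis
  finally show ?thesis .
qed

end
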